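(* Let $V_P,V_Q\subset[n]$ be disjoint. For every initial state $x[0]\in\mathbb{R}^n$, let $G_P[k]=(V_P,E_P(x[k]))$ and $G_Q[k]=(V_Q,E_Q(x[k]))$ be the subgraphs of the influence graph $\tilde G[k]$ induced by $V_P$ and $V_Q$, and let $\mathcal X$ denote the set of all $x[0]\in\mathbb{R}^n$ satisfying the assumptions below: (i) $G_P[k]$ and $G_Q[k]$ merge at time $k_M(x[0])\in\mathbb{N}$ for the first time. (ii) $G_P[k]$ and $G_Q[k]$ are connected graphs, and are connected components of $\tilde G[k]$, for $0\le k<k_M(x[0])$. (iii) No link breaks within $G_P[k]$ or $G_Q[k]$ until time $k_M(x[0])$. Let $G_{P_0}$ and $G_{Q_0}$ be the subgraphs of $G_{ph}$ induced by $V_P$ and $V_Q$, respectively, and let $b$ be the number of boundary edges of $\{G_{P_0},G_{Q_0}\}$ in $G_{ph}$. Let $\{\lambda_d\}_{d=1}^m\cup\{1\}$ be the union of the sets of eigenvalues of the normalized adjacency matrices $A_{P_0}$ and $A_{Q_0}$ of $G_{P_0}$ and $G_{Q_0}$, with $\lambda_d\ne1$ for $d\in[m]$. Suppose $\sup_{x[0]\in\mathcal X}k_M(x[0])=\infty$. Then there exists an index $d\in[m]$ such that $0<\lambda_d<1$ and a corresponding vector $\hat v\in\hat U_d^{PQ}$ (the boundary-restricted eigenspace of $\lambda_d$) satisfying $\hat v_e\ne0$ for some $e\in[b]$ and $\hat v_e\hat v_f\ge0$ for all $e,f\in[b]$.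
   Context: Social Hegselmann-Krause (HK) dynamics: there are $n$ agents, with $[n]=\{1,\dots,n\}$, and a fixed confidence bound $R>0$. The physical connectivity graph $G_{ph}=([n],E_{ph})$ is an undirected, time-invariant, connected graph containing all self-loops. The state at time $k=0,1,2,\dots$ is $x[k]\in\mathbb{R}^n$. The influence graph $\tilde G[k]$ has vertex set $[n]$ and has the edge $(i,j)$ iff $(i,j)\in E_{ph}$ and $|x_i[k]-x_j[k]|\le R$. The update rule is $x_i[k+1]=\frac{1}{|\mathcal N_i[k]|}\sum_{j\in\mathcal N_i[k]}x_j[k]$, where $\mathcal N_i[k]$ is the set of neighbors of $i$ in $\tilde G[k]$ (including $i$ itself). The normalized adjacency matrix of an undirected graph is $D^{-1}A_{adj}$, where $A_{adj}$ is the 0/1 adjacency matrix (with $1$ on the diagonal for a self-loop) and $D$ is the diagonal matrix of row sums of $A_{adj}$. Events. A link break between $i$ and $j$ occurs at time $k\ge1$ if $i,j$ are adjacent in $\tilde G[k-1]$ but non-adjacent in $\tilde G[k]$. Merging: if $\tilde G[k_0-1]$ is a disconnected graph ($k_0\ge1$) and $G_1,G_2$ are the subgraphs of $\tilde G$ induced by vertex sets $V_1,V_2$ that are disconnected from each other in $\tilde G[k_0-1]$, then $G_1$ and $G_2$ merge at time $k_0$ if some $i\in V_1$ and $j\in V_2$ become neighbors at time $k_0$, i.e., are adjacent in $\tilde G[k_0]$. Boundary-restricted eigenspaces. The boundary edges of $\{G_{P_0},G_{Q_0}\}$ in $G_{ph}$ are the edges $\{(i_e,j_e)\}_{e=1}^b\subset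 V_P\times V_Q$ of $G_{ph}$ connecting $V_P$ to $V_Q$. For $d\in[m]$ let $U_d(P)$ be the eigenspace of $A_{P_0}$ for $\lambda_d$ (vectors indexed by $V_P$) if $\lambda_d$ is an eigenvalue of $A_{P_0}$, and $U_d(P)=\{0\}$ otherwise; define $U_d(Q)$ likewise from $A_{Q_0}$. For $u\in U_d(P)$ put $f^P_{br}(u)=[u_{i_1}\ \cdots\ u_{i_b}]^T$ and for $w\in U_d(Q)$ put $f^Q_{br}(w)=[w_{j_1}\ \cdots\ w_{j_b}]^T$. Then $\hat U_d^{PQ}:=\hat U_d^P+\hat U_d^Q\subset\mathbb{R}^b$, where $\hat U_d^P=\mathrm{span}\{f^P_{br}(u):u\in U_d(P)\}$ and $\hat U_d^Q=\mathrm{span}\{f^Q_{br}(w):w\in U_d(Q)\}$. *)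

theory Defs
  imports
    "HOL-Analysis.Analysis"
    "HOL-Library.Extended_Nat"
    "Graph_Theory.Digraph_Component"
begin

text \<open>
  The agents are the elements of a finite index type \<open>'n\<close>, so states are vectors in
  \<open>real ^ 'n\<close>.  An undirected graph is a symmetric digraph without parallel arcs, loops
  being allowed.  The name \<open>connected\<close> also denotes a topological notion, hence the
  qualified name below.
\<close>

definition influence_graph ::
    "'n::finite pair_pre_digraph \<Rightarrow> real \<Rightarrow> real ^ 'n \<Rightarrow> 'n pair_pre_digraph" where
  "influence_graph Gph R x =
     \<lparr> pverts = pverts Gph, parcs = {(i, j) \<in> parcs Gph. \<bar>x $ i - x $ j\<bar> \<le> R} \<rparr>"

definition neighbors :: "('n, 'n \<times> 'n) pre_digraph \<Rightarrow> 'n \<Rightarrow> 'n set" where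
  "neighbors G i = {j. i \<rightarrow>\<^bsub>G\<^esub> j}"

definition hk_step :: "'n::finite pair_pre_digraph \<Rightarrow> real \<Rightarrow> real ^ 'n \<Rightarrow> real ^ 'n" where
  "hk_step Gph R x =
     (\<chi> i. (\<Sum>j\<in>neighbors (influence_graph Gph R x) i. x $ j)
            / real (card (neighbors (influence_graph Gph R x) i)))"

definition hk_state :: "'n::finite pair_pre_digraph \<Rightarrow> real \<Rightarrow> real ^ 'n \<Rightarrow> nat \<Rightarrow> real ^ 'n" where
  "hk_state Gph R x0 k = (hk_step Gph R ^^ k) x0"

definition hk_graph ::
    "'n::finite pair_pre_digraph \<Rightarrow> real \<Rightarrow> real ^ 'n \<Rightarrow> nat \<Rightarrow> ('n, 'n \<times> 'n) pre_digraph" where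
  "hk_graph Gph R x0 k = with_proj (influence_graph Gph R (hk_state Gph R x0 k))"

definition link_break ::
    "'n::finite pair_pre_digraph \<Rightarrow> real \<Rightarrow> real ^ 'n \<Rightarrow> 'n \<Rightarrow> 'n \<Rightarrow> nat \<Rightarrow> bool" where
  "link_break Gph R x0 i j k \<longleftrightarrow>
     1 \<le> k \<and> i \<rightarrow>\<^bsub>hk_graph Gph R x0 (k - 1)\<^esub> j \<and> \<not> i \<rightarrow>\<^bsub>hk_graph Gph R x0 k\<^esub> j"

definition merge_at ::
    "'n::finite pair_pre_digraph \<Rightarrow> real \<Rightarrow> real ^ 'n \<Rightarrow> 'n set \<Rightarrow> 'n set \<Rightarrow> nat \<Rightarrow> bool" where
  "merge_at Gph R x0 V1 V2 k \<longleftrightarrow>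
     1 \<le> k \<and>
     \<not> Digraph_Component.connected (hk_graph Gph R x0 (k - 1)) \<and>
     (\<forall>i\<in>V1. \<forall>j\<in>V2. \<not> i \<rightarrow>\<^sup>*\<^bsub>hk_graph Gph R x0 (k - 1)\<^esub> j) \<and>
     (\<exists>i\<in>V1. \<exists>j\<in>V2. i \<rightarrow>\<^bsub>hk_graph Gph R x0 k\<^esub> j)"

text \<open>The time of the first merging; only meaningful for initial states with some merging.\<close>

definition merge_time ::
    "'n::finite pair_pre_digraph \<Rightarrow> real \<Rightarrow> 'n set \<Rightarrow> 'n set \<Rightarrow> real ^ 'n \<Rightarrow> nat" where
  "merge_time Gph R VP VQ x0 = (LEAST k. merge_at Gph R x0 VP VQ k)"

text \<open>
  The influence graphs are symmetric, so their strongly connected components \<open>sccs\<close> are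
  their connected components.  ``Until the merging time'' is read as excluding that time.
\<close>

definition merging_states ::
    "'n::finite pair_pre_digraph \<Rightarrow> real \<Rightarrow> 'n set \<Rightarrow> 'n set \<Rightarrow> (real ^ 'n) set" where
  "merging_states Gph R VP VQ =
     {x0. (\<exists>k. merge_at Gph R x0 VP VQ k) \<and>
          (\<forall>k < merge_time Gph R VP VQ x0. \<forall>V\<in>{VP, VQ}.
             Digraph_Component.connected (hk_graph Gph R x0 k \<restriction> V) \<and>
             hk_graph Gph R x0 k \<restriction> V \<in> pre_digraph.sccs (hk_graph Gph R x0 k)) \<and>
          (\<forall>k < merge_time Gph R VP VQ x0. \<forall>V\<in>{VP, VQ}. \<forall>i\<in>V. \<forall>j\<in>V.
             \<not> link_break Gph R x0 i j k)}"

text \<open>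
  For a graph on a vertex set \<open>V\<close>, real vectors indexed by \<open>V\<close> are the vectors of
  \<open>real ^ 'n\<close> that vanish outside \<open>V\<close>; matrices indexed by \<open>V\<close> are likewise
  padded with zeros (as \<open>0 / 0 = 0\<close>, the rows outside \<open>V\<close> are zero).  Normalized
  adjacency matrices of undirected graphs are similar to symmetric real matrices when all loops
  are present, so all their eigenvalues are real.
\<close>

definition adjacency_matrix :: "('n::finite, 'n \<times> 'n) pre_digraph \<Rightarrow> real ^ 'n ^ 'n" where
  "adjacency_matrix G = (\<chi> i j. if i \<rightarrow>\<^bsub>G\<^esub> j then 1 else 0)"

definition normalized_adjacency :: "('n::finite, 'n \<times> 'n) pre_digraph \<Rightarrow> real ^ 'n ^ 'n" where
  "normalized_adjacency G =
     (\<chi> i j. adjacency_matrix G $ i $ j / (\<Sum>l\<in>UNIV. adjacency_matrix G $ i $ l))"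

definition eigenvectors0 :: "('n::finite, 'n \<times> 'n) pre_digraph \<Rightarrow> real \<Rightarrow> (real ^ 'n) set" where
  "eigenvectors0 G c =
     {u. (\<forall>i. i \<notin> verts G \<longrightarrow> u $ i = 0) \<and> normalized_adjacency G *v u = c *\<^sub>R u}"

definition eigenvalues :: "('n::finite, 'n \<times> 'n) pre_digraph \<Rightarrow> real set" where
  "eigenvalues G = {c. \<exists>u\<in>eigenvectors0 G c. u \<noteq> 0}"

definition eigenspace :: "('n::finite, 'n \<times> 'n) pre_digraph \<Rightarrow> real \<Rightarrow> (real ^ 'n) set" where
  "eigenspace G c = (if c \<in> eigenvalues G then eigenvectors0 G c else {0})"

text \<open>
  Boundary edges are oriented from \<open>VP\<close> to \<open>VQ\<close>, so that each of them occurs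
  once if \<open>VP\<close> and \<open>VQ\<close> are disjoint.  Vectors indexed by the boundary edges
  are the vectors of \<open>real ^ ('n \<times> 'n)\<close> that vanish outside the set of boundary edges.
\<close>

definition boundary_edges ::
    "'n pair_pre_digraph \<Rightarrow> 'n set \<Rightarrow> 'n set \<Rightarrow> ('n \<times> 'n) set" where
  "boundary_edges Gph VP VQ = {(i, j) \<in> parcs Gph. i \<in> VP \<and> j \<in> VQ}"

definition restrict_P :: "('n \<times> 'n) set \<Rightarrow> real ^ 'n \<Rightarrow> real ^ ('n::finite \<times> 'n)" where
  "restrict_P B u = (\<chi> e. if e \<in> B then u $ fst e else 0)"

definition restrict_Q :: "('n \<times> 'n) set \<Rightarrow> real ^ 'n \<Rightarrow> real ^ ('n::finite \<times> 'n)" where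
  "restrict_Q B w = (\<chi> e. if e \<in> B then w $ snd e else 0)"

definition boundary_eigenspace ::
    "'n::finite pair_pre_digraph \<Rightarrow> 'n set \<Rightarrow> 'n set \<Rightarrow> real \<Rightarrow> (real ^ ('n \<times> 'n)) set" where
  "boundary_eigenspace Gph VP VQ c =
     {p + q | p q.
        p \<in> span (restrict_P (boundary_edges Gph VP VQ) ` eigenspace (with_proj Gph \<restriction> VP) c) \<and>
        q \<in> span (restrict_Q (boundary_edges Gph VP VQ) ` eigenspace (with_proj Gph \<restriction> VQ) c)}"

end

theory Submission
  imports Defs
begin

text \<open>
  Before the merging time \<open>K\<close> each of \<open>VP\<close> and \<open>VQ\<close> averages only over its own members, along
  a connected graph that never loses an edge.  Averaging of this kind contracts the spread of the
  opinions at a rate that depends on the number of agents alone, and the same number bounds the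
  initial spread by a multiple of \<open>R\<close>.  So there is a time \<open>T\<close>, the same for all initial states
  (\<open>uniform_clustering\<close>), after which every opinion within a group stays in an interval of length
  \<open>R / 4\<close>.  From \<open>T\<close> on, all physical links within a group are active and the group evolves by
  powers of its fixed normalized adjacency matrix.  This matrix is similar to a symmetric one,
  hence diagonalizable with real eigenvalues in \<open>]-1, 1]\<close>.

  On a boundary edge the opinions differ by more than \<open>R\<close> before \<open>K\<close>, with a sign that after \<open>T\<close>
  depends neither on the edge nor on the time; at time \<open>K\<close> the distance is at most \<open>R\<close> on some
  boundary edge.  With that sign absorbed, the differences minus \<open>R\<close> form a vector
  \<open>f k = (\<Sum>c. c ^ k * v c)\<close> on the boundary edges.  Here \<open>v c\<close> lies in the boundary-restricted
  eigenspace of \<open>c\<close> if \<open>c \<noteq> 1\<close>, and \<open>v 1\<close> is constant because eigenvectors for \<open>1\<close> on a connected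
  graph are.  The vector \<open>f k\<close> is positive for \<open>k < K - T\<close> but not at \<open>k = K - T\<close>.

  If merging may happen arbitrarily late, consider such vectors \<open>f\<close> with \<open>K \<rightarrow> \<infinity>\<close>, each scaled so
  that its modes at the time of merging have total norm \<open>1\<close>.  A subsequence converges to modes
  \<open>l c\<close> for \<open>c \<noteq> 0\<close>, not all zero, with \<open>(\<Sum>c. c powi (- j) * l c) \<ge> 0\<close> for all \<open>j \<ge> 1\<close>, and with an entry
  that is \<open>\<le> 0\<close> for \<open>j = 0\<close>.  For large \<open>j\<close> the nonzero modes of least modulus \<open>\<rho>\<close> dominate.
  Even and odd \<open>j\<close> together give \<open>l \<rho> \<ge> \<bar>l (- \<rho>)\<bar>\<close>, so \<open>l \<rho>\<close> is nonzero and nonnegative.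
  If \<open>\<rho>\<close> were \<open>1\<close>, the constant mode would be the only one and positive, contradicting the
  entry at \<open>j = 0\<close>.  Thus \<open>l \<rho>\<close> is the required vector
  (\<open>late_sign_change_imp_nonneg_mode\<close>).
\<close>

section \<open>Diagonalization of normalized adjacency matrices\<close>

text \<open>
  The eigenvector is a maximizer of the Rayleigh quotient on the unit sphere of the invariant
  subspace.
\<close>

lemma self_adjoint_eigenvector:
  fixes T :: "'a::euclidean_space \<Rightarrow> 'a"
  assumes lin: "linear T" and adj: "\<And>x y. T x \<bullet> y = x \<bullet> T y"
    and S: "subspace S" "\<And>x. x \<in> S \<Longrightarrow> T x \<in> S" "S \<noteq> {0}"
  obtains \<mu> y where "y \<in> S" "y \<noteq> 0" "T y = \<mu> *\<^sub>R y"
proof -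
  let ?K = "S \<inter> sphere 0 1"
  have "compact ?K"
    using closed_subspace[OF S(1)] compact_Int_closed[OF compact_sphere[of "0::'a" 1]]
    by (simp add: Int_commute)
  obtain z where z: "z \<in> S" "z \<noteq> 0"
    using S(3) subspace_0[OF S(1)] by auto
  then have "(1 / norm z) *\<^sub>R z \<in> ?K"
    using S(1) by (simp add: subspace_scale)
  then have "?K \<noteq> {}" by blast
  have "continuous_on ?K (\<lambda>y. T y \<bullet> y)"
    using lin by (intro continuous_intros linear_continuous_on) (simp add: linear_conv_bounded_linear)
  from continuous_attains_sup[OF \<open>compact ?K\<close> \<open>?K \<noteq> {}\<close> this]
  obtain y where y: "y \<in> S" "norm y = 1" and max: "\<And>z. z \<in> ?K \<Longrightarrow> T z \<bullet> z \<le> T y \<bullet> y"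
    by auto
  define \<mu> where "\<mu> = T y \<bullet> y"
  define h where "h z = \<mu> * (z \<bullet> z) - T z \<bullet> z" for z
  have h_nonneg: "h z \<ge> 0" if "z \<in> S" for z
  proof (cases "z = 0")
    case False
    then have "(1 / norm z) *\<^sub>R z \<in> ?K"
      using that S(1) by (simp add: subspace_scale)
    from max[OF this] have "(T z \<bullet> z) / (norm z)\<^sup>2 \<le> \<mu>"
      by (simp add: linear_scale[OF lin] \<mu>_def power2_eq_square)
    then show ?thesis
      using False by (simp add: h_def field_simps power2_norm_eq_inner)
  qed (simp add: h_def linear_0[OF lin])
  define w where "w = \<mu> *\<^sub>R y - T y"
  have w: "w \<in> S"
    unfolding w_def using S y by (intro subspace_diff subspace_scale) auto
  \<comment> \<open>The form \<open>h\<close> is nonnegative and vanishes at \<open>y\<close>, so its first variation at \<open>y\<close>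
      vanishes in every direction of \<open>S\<close>, in particular along \<open>w\<close>.\<close>
  have expand: "h (y + t *\<^sub>R w) = 2 * t * (w \<bullet> w) + t\<^sup>2 * h w" for t
  proof -
    have "T w \<bullet> y = T y \<bullet> w" using adj[of w y] by (simp add: inner_commute)
    moreover have "y \<bullet> y = 1" using y(2) by (simp add: power2_norm_eq_inner[symmetric])
    ultimately have "h (y + t *\<^sub>R w) = 2 * t * (\<mu> * (y \<bullet> w) - T y \<bullet> w) + t\<^sup>2 * h w"
      by (simp add: h_def linear_add[OF lin] linear_scale[OF lin] inner_add_left inner_add_right
          \<mu>_def[symmetric] inner_commute[of w y] power2_eq_square algebra_simps)
    also have "\<mu> * (y \<bullet> w) - T y \<bullet> w = w \<bullet> w"
      by (subst (3) w_def) (simp add: inner_diff_left)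
    finally show ?thesis .
  qed
  have "w \<bullet> w = 0"
  proof (rule ccontr)
    assume "w \<bullet> w \<noteq> 0"
    then have a: "w \<bullet> w > 0" by simp
    have b: "h w \<ge> 0" using h_nonneg w by blast
    define t where "t = - (w \<bullet> w) / (h w + 1)"
    have "0 \<le> h (y + t *\<^sub>R w)"
      using S(1) y w by (intro h_nonneg subspace_add subspace_scale)
    then have "0 \<le> t * (2 * (w \<bullet> w) + t * h w)"
      by (simp add: expand power2_eq_square algebra_simps)
    moreover have "t < 0" using a b by (simp add: t_def divide_neg_pos)
    ultimately have "2 * (w \<bullet> w) + t * h w \<le> 0" by (simp add: zero_le_mult_iff)
    moreover have "- t * h w \<le> w \<bullet> w"
      using a b by (simp add: t_def field_simps)
    ultimately show False using a by linarith
  qed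
  then have "T y = \<mu> *\<^sub>R y" by (simp add: w_def)
  moreover have "y \<noteq> 0" using y(2) by auto
  ultimately show ?thesis using y(1) that by blast
qed

text \<open>
  The orthogonal complement of all eigenvectors is invariant and, by the previous lemma, trivial.
  Grouping the eigenvectors by a finite set \<open>C\<close> of candidates for eigenvalues, rather than
  choosing an eigenbasis, directly gives the form needed for powers of the operator.
\<close>

lemma self_adjoint_eigen_decomposition:
  fixes T :: "'a::euclidean_space \<Rightarrow> 'a"
  assumes lin: "linear T" and adj: "\<And>x y. T x \<bullet> y = x \<bullet> T y"
    and C: "finite C" "{c. \<exists>y. T y = c *\<^sub>R y \<and> y \<noteq> 0} \<subseteq> C"
  obtains u where "\<And>c. T (u c) = c *\<^sub>R u c" "x = (\<Sum>c\<in>C. u c)"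
proof -
  let ?E = "{y. \<exists>c. T y = c *\<^sub>R y}"
  define N where "N = {y. \<forall>v\<in>?E. y \<bullet> v = 0}"
  have N: "subspace N"
    by (auto simp: N_def subspace_def inner_add_left)
  have "T y \<in> N" if "y \<in> N" for y
  proof -
    have "T y \<bullet> v = 0" if "T v = c *\<^sub>R v" for v c
      using that \<open>y \<in> N\<close> unfolding adj N_def by auto
    then show ?thesis by (auto simp: N_def)
  qed
  have "N = {0}"
  proof (rule ccontr)
    assume "N \<noteq> {0}"
    then obtain \<mu> y where y: "y \<in> N" "y \<noteq> 0" "T y = \<mu> *\<^sub>R y"
      using self_adjoint_eigenvector[OF lin adj N \<open>\<And>y. y \<in> N \<Longrightarrow> T y \<in> N\<close>] by metis
    then have "y \<bullet> y = 0" unfolding N_def by blast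
    then show False using y(2) by simp
  qed
  moreover obtain y z where yz: "y \<in> span ?E" "\<And>w. w \<in> span ?E \<Longrightarrow> orthogonal z w" "x = y + z"
    using orthogonal_subspace_decomp_exists[of ?E x] by blast
  have "z \<in> N"
    using yz(2) by (auto simp: N_def orthogonal_def intro: span_base)
  ultimately have "x \<in> span ?E" using yz by simp
  then have "\<exists>u. (\<forall>c. T (u c) = c *\<^sub>R u c) \<and> x = (\<Sum>c\<in>C. u c)"
  proof (induction rule: span_induct_alt)
    case base
    show ?case by (rule exI[of _ "\<lambda>_. 0"]) (simp add: linear_0[OF lin])
  next
    case (step a v y)
    then obtain c u where c: "T v = c *\<^sub>R v" and u: "\<And>c. T (u c) = c *\<^sub>R u c" "y = (\<Sum>c\<in>C. u c)"
      by auto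
    show ?case
    proof (cases "v = 0")
      case False
      then have "c \<in> C" using C(2) c by blast
      then have "a *\<^sub>R v + y = (\<Sum>d\<in>C. (if d = c then a *\<^sub>R v else 0) + u d)"
        by (simp add: sum.distrib C(1) u(2))
      moreover have "T ((if d = c then a *\<^sub>R v else 0) + u d)
          = d *\<^sub>R ((if d = c then a *\<^sub>R v else 0) + u d)" for d
        by (simp add: linear_add[OF lin] linear_scale[OF lin] linear_0[OF lin] u(1) c scaleR_add_right)
      ultimately show ?thesis
        by (intro exI[of _ "\<lambda>d. (if d = c then a *\<^sub>R v else 0) + u d"] conjI allI)
    qed (use u in auto)
  qed
  then obtain u where u: "\<forall>c. T (u c) = c *\<^sub>R u c" "x = (\<Sum>c\<in>C. u c)" by blast
  show ?thesis by (rule that[OF u(1)[rule_format] u(2)])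
qed

text \<open>
  For the diagonal matrix \<open>S\<close> of square roots of the degrees, \<open>D\<^sup>-\<^sup>1 A\<close> is conjugate to the
  symmetric matrix \<open>S\<^sup>-\<^sup>1 A S\<^sup>-\<^sup>1\<close>.  The candidate \<open>0\<close> is included in \<open>C\<close> because padding the matrix
  with zeros makes all vectors supported outside the graph eigenvectors for \<open>0\<close>.
\<close>

lemma normalized_adjacency_eigen_decomposition:
  fixes G :: "('n::finite, 'n \<times> 'n) pre_digraph"
  assumes dom: "\<And>i j. i \<rightarrow>\<^bsub>G\<^esub> j \<Longrightarrow> i \<in> verts G \<and> j \<rightarrow>\<^bsub>G\<^esub> i"
    and loops: "\<And>i. i \<in> verts G \<Longrightarrow> i \<rightarrow>\<^bsub>G\<^esub> i"
    and C: "finite C" "eigenvalues G \<union> {0} \<subseteq> C"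
    and x: "\<And>i. i \<notin> verts G \<Longrightarrow> x $ i = 0"
  obtains u where "\<And>c. u c \<in> eigenvectors0 G c" "x = (\<Sum>c\<in>C. u c)"
proof -
  let ?A = "\<lambda>i j. adjacency_matrix G $ i $ j"
  define s where "s i = sqrt (\<Sum>l\<in>UNIV. ?A i l)" for i
  have s0: "s i = 0 \<longleftrightarrow> i \<notin> verts G" for i
  proof -
    have "s i = 0 \<longleftrightarrow> (\<forall>l. \<not> i \<rightarrow>\<^bsub>G\<^esub> l)"
      by (auto simp: s_def adjacency_matrix_def sum_nonneg_eq_0_iff)
    then show ?thesis using dom loops by blast
  qed
  have deg: "(\<Sum>l\<in>UNIV. ?A i l) = s i * s i" for i
    by (simp add: s_def sum_nonneg adjacency_matrix_def)
  have symA: "?A i j = ?A j i" for i j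
    using dom by (auto simp: adjacency_matrix_def)
  \<comment> \<open>Outside the graph \<open>s\<close> is zero, and division by zero makes \<open>D\<close> map every vector to one
      supported on the graph.\<close>
  define T where "T y = (\<chi> i. \<Sum>j\<in>UNIV. ?A i j / (s i * s j) * y $ j)" for y
  define D where "D y = (\<chi> i. y $ i / s i)" for y :: "real ^ 'n"
  have lin: "linear T"
    by (rule linearI) (simp_all add: T_def vec_eq_iff algebra_simps sum.distrib add_divide_distrib
        sum_distrib_left)
  have adj: "T x \<bullet> y = x \<bullet> T y" for x y
  proof -
    have "T x \<bullet> y = (\<Sum>i\<in>UNIV. \<Sum>j\<in>UNIV. ?A i j / (s i * s j) * x $ j * y $ i)"
      by (simp add: T_def inner_vec_def sum_distrib_right)
    also have "\<dots> = (\<Sum>j\<in>UNIV. \<Sum>i\<in>UNIV. ?A i j / (s i * s j) * x $ j * y $ i)"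
      by (rule sum.swap)
    also have "\<dots> = (\<Sum>j\<in>UNIV. \<Sum>i\<in>UNIV. x $ j * (?A j i / (s j * s i) * y $ i))"
    proof (intro sum.cong refl)
      fix i j
      show "?A i j / (s i * s j) * x $ j * y $ i = x $ j * (?A j i / (s j * s i) * y $ i)"
        unfolding symA[of i j] by (simp only: mult_ac times_divide_eq_left times_divide_eq_right)
    qed
    also have "\<dots> = x \<bullet> T y"
      by (simp add: T_def inner_vec_def sum_distrib_left)
    finally show ?thesis .
  qed
  have D_eigen: "D y \<in> eigenvectors0 G c" if "T y = c *\<^sub>R y" for y c
  proof -
    have "(normalized_adjacency G *v D y) $ i = T y $ i / s i" for i
      by (simp add: normalized_adjacency_def deg matrix_vector_mult_def D_def T_def
          sum_divide_distrib mult_ac)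
    then have "normalized_adjacency G *v D y = c *\<^sub>R D y"
      by (simp add: vec_eq_iff that D_def)
    then show ?thesis by (auto simp: eigenvectors0_def D_def s0)
  qed
  have "c \<in> C" if y: "T y = c *\<^sub>R y" "y \<noteq> 0" for c y
  proof (cases "D y = 0")
    case False
    then have "c \<in> eigenvalues G" using D_eigen[OF y(1)] by (auto simp: eigenvalues_def)
    then show ?thesis using C(2) by blast
  next
    case True
    then have "?A i j / (s i * s j) * y $ j = 0" for i j
      by (auto simp: D_def vec_eq_iff)
    then have "T y = 0" by (simp only: T_def vec_eq_iff) simp
    then show ?thesis using y C(2) by auto
  qed
  then have "{c. \<exists>y. T y = c *\<^sub>R y \<and> y \<noteq> 0} \<subseteq> C" by blast
  from self_adjoint_eigen_decomposition[OF lin adj C(1) this, where x = "\<chi> i. s i * x $ i"]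
  obtain u where u: "\<And>c. T (u c) = c *\<^sub>R u c" "(\<chi> i. s i * x $ i) = (\<Sum>c\<in>C. u c)" by blast
  have "x = D (\<chi> i. s i * x $ i)"
    using x s0 by (auto simp: D_def vec_eq_iff)
  also have "\<dots> = (\<Sum>c\<in>C. D (u c))"
    unfolding u(2) by (simp add: D_def vec_eq_iff sum_divide_distrib)
  finally show ?thesis using that[of "\<lambda>c. D (u c)"] D_eigen u(1) by blast
qed

section \<open>Late sign changes of sums of geometric modes\<close>

lemma simultaneous_convergent_subsequence:
  fixes a :: "nat \<Rightarrow> 'c \<Rightarrow> 'b::heine_borel"
  assumes "finite C" "\<forall>c\<in>C. bounded (range (\<lambda>s. a s c))"
  obtains r l where "strict_mono (r :: nat \<Rightarrow> nat)" "\<forall>c\<in>C. (\<lambda>s. a (r s) c) \<longlonglongrightarrow> l c"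
proof -
  have "\<exists>l r. strict_mono (r :: nat \<Rightarrow> nat) \<and> (\<forall>c\<in>C. (\<lambda>s. a (r s) c) \<longlonglongrightarrow> l c)"
    using assms
  proof (induction rule: finite_induct)
    case empty
    show ?case using strict_mono_id by fastforce
  next
    case (insert d C)
    then obtain l r where r: "strict_mono (r :: nat \<Rightarrow> nat)"
      and l: "\<And>c. c \<in> C \<Longrightarrow> (\<lambda>s. a (r s) c) \<longlonglongrightarrow> l c" by auto
    have "bounded (range (\<lambda>s. a (r s) d))"
      using insert.prems by (auto intro: bounded_subset)
    from bounded_imp_convergent_subsequence[OF this]
    obtain m q where q: "strict_mono (q :: nat \<Rightarrow> nat)" and m: "(\<lambda>s. a (r (q s)) d) \<longlonglongrightarrow> m"
      by (auto simp: o_def)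
    have "(\<lambda>s. a (r (q s)) c) \<longlonglongrightarrow> (l(d := m)) c" if "c \<in> insert d C" for c
      using that m LIMSEQ_subseq_LIMSEQ[OF l q, of c] by (auto simp: o_def)
    moreover have "strict_mono (\<lambda>s. r (q s))"
      using strict_mono_o[OF r q] by (simp add: o_def)
    ultimately show ?case by blast
  qed
  then show ?thesis using that by blast
qed

text \<open>
  If sums of modes stay positive for arbitrarily long and then fail to be positive, one of the
  positive rates below \<open>1\<close> has a nonnegative mode.  The index \<open>k = 0\<close> is left out of the positivity
  hypothesis so that a mode of rate \<open>0\<close>, which is present at that index only, can be dropped.
\<close>

lemma late_sign_change_imp_nonneg_mode:
  fixes V :: "real \<Rightarrow> (real ^ 'e) set"
  assumes C: "finite C" "\<And>c. c \<in> C \<Longrightarrow> -1 < c \<and> c \<le> 1 \<and> c \<noteq> 0"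
    and V: "\<And>c. c \<in> C \<Longrightarrow> subspace (V c)"
    and supp: "\<And>c v i. c \<in> C \<Longrightarrow> v \<in> V c \<Longrightarrow> i \<notin> E \<Longrightarrow> v $ i = 0"
    and const: "\<And>v i j. v \<in> V 1 \<Longrightarrow> i \<in> E \<Longrightarrow> j \<in> E \<Longrightarrow> v $ i = v $ j"
    and late: "\<And>N. \<exists>K v. N \<le> K \<and> (\<forall>c\<in>C. v c \<in> V c)
      \<and> (\<forall>k\<in>{1..<K}. \<forall>e\<in>E. 0 < (\<Sum>c\<in>C. c ^ k * v c $ e))
      \<and> (\<exists>e\<in>E. (\<Sum>c\<in>C. c ^ K * v c $ e) \<le> 0)"
  shows "\<exists>c\<in>C. 0 < c \<and> c < 1 \<and> (\<exists>v\<in>V c. (\<exists>e\<in>E. v $ e \<noteq> 0) \<and> (\<forall>e\<in>E. 0 \<le> v $ e))"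
proof -
  define late_at where "late_at s K v \<longleftrightarrow> s + 2 \<le> K \<and> (\<forall>c\<in>C. v c \<in> V c)
      \<and> (\<forall>k\<in>{1..<K}. \<forall>e\<in>E. 0 < (\<Sum>c\<in>C. c ^ k * v c $ e))
      \<and> (\<exists>e\<in>E. (\<Sum>c\<in>C. c ^ K * v c $ e) \<le> 0)" for s K v
  have "\<forall>s. \<exists>K v. late_at s K v"
    unfolding late_at_def by (intro allI late)
  from choice[OF this] obtain K where "\<forall>s. \<exists>v. late_at s (K s) v" ..
  from choice[OF this] obtain v where v: "\<forall>s. late_at s (K s) (v s)" ..
  have K: "s + 2 \<le> K s" and vV: "c \<in> C \<Longrightarrow> v s c \<in> V c"
    and vpos: "k \<in> {1..<K s} \<Longrightarrow> e \<in> E \<Longrightarrow> 0 < (\<Sum>c\<in>C. c ^ k * v s c $ e)"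
    and vneg: "\<exists>e\<in>E. (\<Sum>c\<in>C. c ^ K s * v s c $ e) \<le> 0" for s c k e
    using v[rule_format, of s] unfolding late_at_def by auto
  define N where "N s = (\<Sum>c\<in>C. norm (c ^ K s *\<^sub>R v s c))" for s
  have N: "N s > 0" for s
  proof -
    obtain e where e: "e \<in> E" using vneg by blast
    have "1 \<in> {1..<K s}" using K[of s] by auto
    from vpos[OF this e] have "\<exists>c\<in>C. v s c \<noteq> 0"
      by (metis (no_types, lifting) less_irrefl mult_zero_right sum.neutral zero_index)
    then obtain c where "c \<in> C" "0 < norm (c ^ K s *\<^sub>R v s c)"
      using C by fastforce
    then show ?thesis unfolding N_def
      by (intro sum_pos2[OF C(1)]) auto
  qed
  \<comment> \<open>Each trajectory is rescaled at its own time of sign change, which bounds its modes, so they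
      converge along a subsequence.\<close>
  define a where "a s c = (1 / N s) *\<^sub>R (c ^ K s *\<^sub>R v s c)" for s c
  have aV: "a s c \<in> V c" if "c \<in> C" for s c
    unfolding a_def using V vV that by (intro subspace_scale)
  have a1: "(\<Sum>c\<in>C. norm (a s c)) = 1" for s
  proof -
    have "norm (a s c) = norm (c ^ K s *\<^sub>R v s c) / N s" for c
      using N[of s] by (simp add: a_def)
    then have "(\<Sum>c\<in>C. norm (a s c)) = N s / N s"
      unfolding N_def[of s] by (simp only: sum_divide_distrib)
    then show ?thesis using N[of s] by simp
  qed
  \<comment> \<open>Going back \<open>j\<close> steps from the time of sign change divides the mode of rate \<open>c\<close> by \<open>c ^ j\<close>.\<close>
  have a_back: "(\<Sum>c\<in>C. (1 / c) ^ j * a s c $ e) = (\<Sum>c\<in>C. c ^ (K s - j) * v s c $ e) / N s"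
    if "j \<le> K s" for s j e
    unfolding sum_divide_distrib
  proof (intro sum.cong refl)
    fix c assume "c \<in> C"
    then have "(1 / c) ^ j * c ^ K s = c ^ (K s - j)"
      using C(2)[of c] that by (simp add: power_diff power_one_over field_simps)
    then show "(1 / c) ^ j * a s c $ e = c ^ (K s - j) * v s c $ e / N s"
      by (simp add: a_def mult.assoc[symmetric])
  qed
  have "bounded (range (\<lambda>s. a s c))" if "c \<in> C" for c
  proof -
    have "norm (a s c) \<le> 1" for s
      using member_le_sum[OF that, of "\<lambda>c. norm (a s c)"] C(1) a1[of s] by simp
    then show ?thesis by (auto simp: bounded_iff)
  qed
  then have "\<forall>c\<in>C. bounded (range (\<lambda>s. a s c))" by blast
  then obtain l r where r: "strict_mono (r :: nat \<Rightarrow> nat)"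
    and l: "\<forall>c\<in>C. (\<lambda>s. a (r s) c) \<longlonglongrightarrow> l c"
    by (rule simultaneous_convergent_subsequence[OF C(1)])
  note lim = l[rule_format]
  have lV: "l c \<in> V c" if "c \<in> C" for c
    using closed_sequentially[OF closed_subspace[OF V[OF that]] _ lim[OF that]] aV[OF that] by blast
  have l1: "(\<Sum>c\<in>C. norm (l c)) = 1"
  proof -
    have "(\<lambda>s. \<Sum>c\<in>C. norm (a (r s) c)) \<longlonglongrightarrow> (\<Sum>c\<in>C. norm (l c))"
      by (intro tendsto_intros lim)
    then show ?thesis using LIMSEQ_unique[OF _ tendsto_const] by (simp add: a1)
  qed
  have lim_back: "(\<lambda>s. \<Sum>c\<in>C. (1 / c) ^ j * a (r s) c $ e) \<longlonglongrightarrow> (\<Sum>c\<in>C. (1 / c) ^ j * l c $ e)"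
    for j e
    by (intro tendsto_intros lim)
  have past: "0 \<le> (\<Sum>c\<in>C. (1 / c) ^ j * l c $ e)" if "1 \<le> j" "e \<in> E" for j e
  proof (rule LIMSEQ_le_const[OF lim_back], intro exI allI impI)
    fix s assume "j \<le> s"
    then have j: "j \<le> K (r s)" "K (r s) - j \<in> {1..<K (r s)}"
      using K[of "r s"] seq_suble[OF r, of s] that by auto
    show "0 \<le> (\<Sum>c\<in>C. (1 / c) ^ j * a (r s) c $ e)"
      unfolding a_back[OF j(1)] using vpos[OF j(2) that(2)] N[of "r s"] by simp
  qed
  have "\<exists>e\<in>E. (\<Sum>c\<in>C. l c $ e) \<le> 0"
  proof (rule ccontr)
    assume "\<not> ?thesis"
    then have "\<forall>e\<in>E. 0 < (\<Sum>c\<in>C. l c $ e)" by force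
    then have "\<forall>e\<in>E. \<forall>\<^sub>F s in sequentially. 0 < (\<Sum>c\<in>C. a (r s) c $ e)"
      using order_tendstoD(1)[OF lim_back[of 0], of 0] by simp
    then have "\<forall>\<^sub>F s in sequentially. \<forall>e\<in>E. 0 < (\<Sum>c\<in>C. a (r s) c $ e)"
      by (intro eventually_ball_finite) auto
    then obtain s where s: "\<And>e. e \<in> E \<Longrightarrow> 0 < (\<Sum>c\<in>C. a (r s) c $ e)"
      using eventually_happens'[OF sequentially_bot] by blast
    obtain e where e: "e \<in> E" "(\<Sum>c\<in>C. c ^ K (r s) * v (r s) c $ e) \<le> 0" using vneg by blast
    then have "(\<Sum>c\<in>C. a (r s) c $ e) \<le> 0"
      using a_back[of 0 "r s" e] N[of "r s"] by (simp add: divide_nonpos_pos)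
    then show False using s[OF e(1)] by linarith
  qed
  then obtain e0 where e0: "e0 \<in> E" "(\<Sum>c\<in>C. l c $ e0) \<le> 0" by blast
  define S where "S = {c \<in> C. l c \<noteq> 0}"
  have S: "finite S" "S \<noteq> {}"
  proof -
    show "finite S" using C(1) by (simp add: S_def)
    have "(\<Sum>c\<in>C. norm (l c)) = 0" if "S = {}"
      using that by (intro sum.neutral) (auto simp: S_def)
    then show "S \<noteq> {}" using l1 by auto
  qed
  define \<rho> where "\<rho> = Min (abs ` S)"
  have "\<rho> \<in> abs ` S" unfolding \<rho>_def using S by simp
  then obtain c0 where c0: "c0 \<in> C" "l c0 \<noteq> 0" "\<bar>c0\<bar> = \<rho>" by (auto simp: S_def)
  have \<rho>: "0 < \<rho>" "\<rho> \<le> 1" using c0 C(2)[of c0] by auto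
  have small: "l c = 0" if "c \<in> C" "\<bar>c\<bar> < \<rho>" for c
  proof (rule ccontr)
    assume "l c \<noteq> 0"
    then have "\<rho> \<le> \<bar>c\<bar>" unfolding \<rho>_def using S that by (intro Min_le) (auto simp: S_def)
    then show False using that by simp
  qed
  define b where "b c = (if c \<in> C then l c else 0)" for c
  \<comment> \<open>Far back in time the modes of least modulus dominate; the two parities of the time
      separate \<open>\<rho>\<close> from \<open>- \<rho>\<close>.\<close>
  have dominant: "0 \<le> b \<rho> $ e + (-1) ^ p * b (- \<rho>) $ e" if e: "e \<in> E" for e and p :: nat
  proof -
    have lim_c: "(\<lambda>i. (\<rho> / c) ^ (2 * i + p) * l c $ e)
        \<longlonglongrightarrow> (if c = \<rho> then l c $ e else 0) + (if c = - \<rho> then (-1) ^ p * l c $ e else 0)"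
      if c: "c \<in> C" for c
    proof -
      consider "c = \<rho>" | "c = - \<rho>" | "\<bar>c\<bar> < \<rho>" | "\<bar>c\<bar> > \<rho>" by linarith
      then show ?thesis
      proof cases
        case 4
        then have "\<bar>\<rho> / c\<bar> < 1"
          using \<rho> by simp
        then have "norm ((\<rho> / c)\<^sup>2) < 1"
          unfolding real_norm_def abs_power2 abs_square_less_1 .
        then have "(\<lambda>i. ((\<rho> / c)\<^sup>2) ^ i * ((\<rho> / c) ^ p * l c $ e)) \<longlonglongrightarrow> 0"
          by (intro tendsto_mult_left_zero LIMSEQ_power_zero)
        moreover have "c \<noteq> \<rho>" "c \<noteq> - \<rho>" using 4 \<rho> by auto
        ultimately show ?thesis by (simp add: power_add power_mult mult.assoc)
      qed (use \<rho> small[OF c] in \<open>auto simp: power_add power_mult\<close>)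
    qed
    have "(\<lambda>i. \<Sum>c\<in>C. (\<rho> / c) ^ (2 * i + p) * l c $ e)
        \<longlonglongrightarrow> (\<Sum>c\<in>C. (if c = \<rho> then l c $ e else 0) + (if c = - \<rho> then (-1) ^ p * l c $ e else 0))"
      by (intro tendsto_sum lim_c)
    also have "(\<Sum>c\<in>C. (if c = \<rho> then l c $ e else 0) + (if c = - \<rho> then (-1) ^ p * l c $ e else 0))
        = b \<rho> $ e + (-1) ^ p * b (- \<rho>) $ e"
      by (simp add: sum.distrib C(1) b_def)
    finally show ?thesis
    proof (rule LIMSEQ_le_const, intro exI[of _ 1] allI impI)
      fix i :: nat assume "1 \<le> i"
      then have "0 \<le> \<rho> ^ (2 * i + p) * (\<Sum>c\<in>C. (1 / c) ^ (2 * i + p) * l c $ e)"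
        using \<rho> e by (intro mult_nonneg_nonneg past) auto
      then show "0 \<le> (\<Sum>c\<in>C. (\<rho> / c) ^ (2 * i + p) * l c $ e)"
        by (simp add: sum_distrib_left power_divide)
    qed
  qed
  have nonneg: "0 \<le> b \<rho> $ e" and le: "b \<rho> $ e = 0 \<Longrightarrow> b (- \<rho>) $ e = 0" if "e \<in> E" for e
    using dominant[OF that, of 0] dominant[OF that, of 1] by auto
  have bsupp: "b c $ e = 0" if "e \<notin> E" for c e
    using supp[OF _ lV that] by (auto simp: b_def)
  \<comment> \<open>A mode of rate \<open>- \<rho>\<close> alone would alternate in sign.\<close>
  have "b \<rho> \<noteq> 0"
  proof
    assume 0: "b \<rho> = 0"
    then have "b (- \<rho>) $ e = 0" for e
      using le[of e] bsupp[of e] by (cases "e \<in> E") auto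
    then have "b (- \<rho>) = 0" by (simp add: vec_eq_iff)
    then show False using 0 c0 by (auto simp: b_def abs_if split: if_splits)
  qed
  then have \<rho>C: "\<rho> \<in> C" and "l \<rho> \<noteq> 0" by (auto simp: b_def split: if_splits)
  then obtain e1 where e1: "e1 \<in> E" "l \<rho> $ e1 \<noteq> 0"
    using bsupp[of _ \<rho>] by (auto simp: vec_eq_iff b_def)
  \<comment> \<open>Otherwise the constant mode is the only nonzero one; it is nonnegative, so it would have to
      vanish at \<open>e0\<close> and hence everywhere.\<close>
  have "\<rho> \<noteq> 1"
  proof
    assume 1: "\<rho> = 1"
    have "(\<Sum>c\<in>C. l c $ e0) = (\<Sum>c\<in>C. if c = 1 then l c $ e0 else 0)"
    proof (intro sum.cong refl)
      fix c assume "c \<in> C"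
      then show "l c $ e0 = (if c = 1 then l c $ e0 else 0)"
        using small[of c] C(2)[of c] 1 by force
    qed
    then have "l 1 $ e0 \<le> 0" using e0(2) C(1) \<rho>C 1 by simp
    moreover have "l 1 $ e0 = l 1 $ e1" using const lV \<rho>C 1 e0(1) e1(1) by blast
    ultimately show False using nonneg[OF e1(1)] e1(2) 1 \<rho>C by (simp add: b_def)
  qed
  then show ?thesis
    using \<rho> \<rho>C lV[OF \<rho>C] e1 nonneg by (intro bexI[of _ \<rho>] conjI bexI[of _ "l \<rho>"]) (auto simp: b_def)
qed

section \<open>Contraction by averaging over growing neighborhoods\<close>

text \<open>
  The behaviour of one group up to the merging time, which is the horizon \<open>K\<close>: repeated averaging
  over neighborhoods within \<open>V\<close> that only grow and are connected from the start.
\<close>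

locale averaging_run =
  fixes V :: "'n::finite set" and nb :: "nat \<Rightarrow> 'n \<Rightarrow> 'n set"
    and x :: "nat \<Rightarrow> real ^ 'n" and K :: nat
  assumes step: "k < K \<Longrightarrow> i \<in> V \<Longrightarrow> x (Suc k) $ i = (\<Sum>j\<in>nb k i. x k $ j) / real (card (nb k i))"
    and self: "k < K \<Longrightarrow> i \<in> V \<Longrightarrow> i \<in> nb k i"
    and closed: "k < K \<Longrightarrow> i \<in> V \<Longrightarrow> nb k i \<subseteq> V"
    and mono: "k \<le> l \<Longrightarrow> l < K \<Longrightarrow> i \<in> V \<Longrightarrow> nb k i \<subseteq> nb l i"
    and conn: "i \<in> V \<Longrightarrow> j \<in> V \<Longrightarrow> (i, j) \<in> {(a, b). a \<in> V \<and> b \<in> nb 0 a}\<^sup>*"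
    and horizon: "0 < K"
begin

abbreviation links :: "('n \<times> 'n) set" where
  "links \<equiv> {(a, b). a \<in> V \<and> b \<in> nb 0 a}"

lemma card_nb_pos: "k < K \<Longrightarrow> i \<in> V \<Longrightarrow> 0 < card (nb k i)"
  using self by (auto simp: card_gt_0_iff)

lemma hull_decreasing:
  assumes "k \<le> l" "l \<le> K" "\<forall>i\<in>V. x k $ i \<in> {a..b}"
  shows "\<forall>i\<in>V. x l $ i \<in> {a..b}"
  using assms(1,2)
proof (induction l rule: dec_induct)
  case base
  show ?case by (rule assms(3))
next
  case (step l)
  show ?case
  proof
    fix i assume i: "i \<in> V"
    have l: "l < K" using step by simp
    have "x l $ j \<in> {a..b}" if "j \<in> nb l i" for j
      using that closed[OF l i] step by auto
    then have "card (nb l i) * a \<le> (\<Sum>j\<in>nb l i. x l $ j)" "(\<Sum>j\<in>nb l i. x l $ j) \<le> card (nb l i) * b"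
      by (auto intro!: sum_bounded_below sum_bounded_above)
    then show "x (Suc l) $ i \<in> {a..b}"
      using card_nb_pos[OF l i] by (simp add: averaging_run.step[OF averaging_run_axioms l i] field_simps)
  qed
qed

text \<open>
  If one agent exceeds the minimum of its group by \<open>d\<close>, then one step later every agent that
  listens to it exceeds this minimum by at least \<open>d\<close> divided by the number of agents, since an
  average has at most that many terms and the other terms are at least the minimum.  Initial
  links persist, so this repeats along paths of initial links.
\<close>

lemma excess_propagates:
  assumes "\<forall>i\<in>V. a \<le> x k $ i" "a + d \<le> x k $ j" "0 \<le> d"
    and "(i, j) \<in> links ^^ t" "k + t \<le> K" "i \<in> V" "j \<in> V"
  shows "a + d / real CARD('n) ^ t \<le> x (k + t) $ i"
  using assms(4-6)
proof (induction t arbitrary: i)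
  case 0
  then show ?case using assms(2) by simp
next
  case (Suc t)
  from relpow_Suc_D2[OF Suc.prems(1)] obtain h
    where h: "(i, h) \<in> links" "(h, j) \<in> links ^^ t" by blast
  have l: "k + t < K" and i: "i \<in> V" using Suc.prems by auto
  have hV: "h \<in> V" using h(1) closed[of 0 i] l by auto
  have hnb: "h \<in> nb (k + t) i" using h(1) mono[of 0 "k + t" i] l i by auto
  have IH: "a + d / real CARD('n) ^ t \<le> x (k + t) $ h"
    using Suc.IH[OF h(2)] Suc.prems(2) hV by simp
  obtain b where "\<forall>i\<in>V. x k $ i \<in> {a..b}"
  proof
    show "\<forall>i\<in>V. x k $ i \<in> {a..Max (range (($) (x k)))}" using assms(1) by simp
  qed
  then have low: "\<forall>i\<in>V. a \<le> x (k + t) $ i"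
    using hull_decreasing[of k "k + t"] l by fastforce
  let ?N = "nb (k + t) i" and ?n = "real CARD('n)"
  have c: "0 < card ?N" "real (card ?N) \<le> ?n"
    using card_nb_pos[OF l i] by (auto intro: card_mono)
  have "x (k + t) $ h - a \<le> (\<Sum>g\<in>?N. x (k + t) $ g - a)"
    using low closed[OF l i] hnb by (intro member_le_sum) auto
  also have "\<dots> = (x (Suc (k + t)) $ i - a) * card ?N"
    using c by (simp add: step[OF l i] sum_subtractf field_simps)
  finally have ge: "d / ?n ^ t \<le> (x (Suc (k + t)) $ i - a) * card ?N" using IH by linarith
  have "0 \<le> x (Suc (k + t)) $ i - a"
    using ge c assms(3) by (smt (verit) divide_nonneg_nonneg mult_neg_pos of_nat_0_less_iff of_nat_0_le_iff zero_le_power mult_less_0_iff)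
  then have "d / ?n ^ t \<le> (x (Suc (k + t)) $ i - a) * ?n"
    using ge c by (meson mult_left_mono order_trans)
  then show ?case by (simp add: field_simps)
qed

text \<open>
  Path lengths are bounded by the number of links, and the self-loops pad all paths to the same
  length.
\<close>

lemma linked_in_card_steps:
  assumes "i \<in> V" "j \<in> V"
  shows "(i, j) \<in> links ^^ CARD('n \<times> 'n)"
proof -
  have "finite links" by (rule finite)
  then obtain t where t: "t \<le> card links" "(i, j) \<in> links ^^ t"
    using conn[OF assms] by (auto simp: rtrancl_finite_eq_relpow)
  have "card links \<le> CARD('n \<times> 'n)" by (rule card_mono) auto
  moreover have "(i, i) \<in> links ^^ s" for s
  proof (induction s)
    case (Suc s)
    then show ?case using assms(1) self[OF horizon assms(1)] by (auto intro: relcompI)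
  qed simp
  ultimately show ?thesis
    using t relpow_add[of "CARD('n \<times> 'n) - t" t links] by (auto intro: relcompI)
qed

text \<open>
  Either some agent is in the upper half of the interval, and its excess over the lower end
  spreads to all agents, or all agents are in the lower half.
\<close>

lemma spread_contracts:
  assumes a: "\<forall>i\<in>V. x k $ i \<in> {a..a + d}" and k: "k + CARD('n \<times> 'n) \<le> K"
  shows "\<exists>a'. \<forall>i\<in>V. x (k + CARD('n \<times> 'n)) $ i
    \<in> {a'..a' + (1 - 1 / (2 * real CARD('n) ^ CARD('n \<times> 'n))) * d}"
proof (cases "V = {}")
  case False
  let ?N = "CARD('n \<times> 'n)" and ?n = "real CARD('n)"
  have d: "0 \<le> d" using a False by force
  have n: "1 \<le> ?n ^ ?N" by (rule one_le_power) simp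
  show ?thesis
  proof (cases "\<exists>j\<in>V. a + d / 2 \<le> x k $ j")
    case True
    then obtain j where j: "j \<in> V" "a + d / 2 \<le> x k $ j" by blast
    have "a + (d / 2) / ?n ^ ?N \<le> x (k + ?N) $ i" if "i \<in> V" for i
      using a d j(1) k that by (intro excess_propagates[OF _ j(2)] linked_in_card_steps) auto
    moreover have "x (k + ?N) $ i \<le> a + d" if "i \<in> V" for i
      using hull_decreasing[OF _ k a] that by auto
    ultimately show ?thesis
      by (intro exI[of _ "a + (d / 2) / ?n ^ ?N"]) (auto simp: algebra_simps)
  next
    case False
    then have "\<forall>i\<in>V. x k $ i \<in> {a..a + d / 2}" using a by force
    then have h: "\<forall>i\<in>V. x (k + ?N) $ i \<in> {a..a + d / 2}"
      using hull_decreasing k by (metis le_add1)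
    have "1 / (2 * ?n ^ ?N) \<le> 1 / 2" using n by (simp add: field_simps)
    then have "1 / 2 * d \<le> (1 - 1 / (2 * ?n ^ ?N)) * d"
      using d by (intro mult_right_mono) auto
    then show ?thesis using h by (intro exI[of _ a]) fastforce
  qed
qed simp

lemma spread_contracts_iterated:
  assumes a: "\<forall>i\<in>V. x 0 $ i \<in> {a..a + d}" and m: "m * CARD('n \<times> 'n) \<le> K"
  shows "\<exists>a'. \<forall>i\<in>V. x (m * CARD('n \<times> 'n)) $ i
    \<in> {a'..a' + (1 - 1 / (2 * real CARD('n) ^ CARD('n \<times> 'n))) ^ m * d}"
  using m
proof (induction m)
  case 0
  then show ?case using a by auto
next
  case (Suc m)
  then obtain a' where "\<forall>i\<in>V. x (m * CARD('n \<times> 'n)) $ i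
      \<in> {a'..a' + (1 - 1 / (2 * real CARD('n) ^ CARD('n \<times> 'n))) ^ m * d}" by auto
  from spread_contracts[OF this] Suc.prems show ?case
    by (simp add: add.commute mult.assoc)
qed

lemma initial_spread:
  assumes R: "\<And>i j. i \<in> V \<Longrightarrow> j \<in> nb 0 i \<Longrightarrow> \<bar>x 0 $ i - x 0 $ j\<bar> \<le> R"
  shows "\<exists>a. \<forall>i\<in>V. x 0 $ i \<in> {a..a + 2 * (real CARD('n \<times> 'n) * R)}"
proof (cases "V = {}")
  case False
  then obtain i where i: "i \<in> V" by blast
  have "\<bar>x 0 $ i - x 0 $ j\<bar> \<le> real t * R" if "(i, j) \<in> links ^^ t" for t j
    using that
  proof (induction t arbitrary: j)
    case (Suc t)
    then obtain h where h: "(i, h) \<in> links ^^ t" "h \<in> V" "j \<in> nb 0 h" by auto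
    then show ?case using Suc.IH[OF h(1)] R[OF h(2,3)] by (simp add: algebra_simps)
  qed simp
  then have near: "\<bar>x 0 $ i - x 0 $ j\<bar> \<le> real CARD('n \<times> 'n) * R" if "j \<in> V" for j
    using linked_in_card_steps[OF i that] by blast
  have "x 0 $ j \<in> {x 0 $ i - s..x 0 $ i - s + 2 * s}" if "\<bar>x 0 $ i - x 0 $ j\<bar> \<le> s" for j s
    using that by auto
  then show ?thesis using near by blast
qed simp

end

text \<open>
  The contraction factor and the bound on the initial spread depend only on \<open>R\<close> and on the number
  of agents, so one time \<open>T\<close> serves all runs.  Opinions at two different times are compared
  since the intervals containing them are nested.
\<close>

lemma uniform_clustering:
  fixes R \<epsilon> :: real
  assumes "0 < \<epsilon>"
  shows "\<exists>T. \<forall>(V :: 'n::finite set) nb x K. averaging_run V nb x K \<longrightarrow>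
    (\<forall>i\<in>V. \<forall>j\<in>nb 0 i. \<bar>x 0 $ i - x 0 $ j\<bar> \<le> R) \<longrightarrow>
    (\<forall>k\<in>{T..K}. \<forall>l\<in>{T..K}. \<forall>i\<in>V. \<forall>j\<in>V. \<bar>x k $ i - x l $ j\<bar> \<le> \<epsilon>)"
proof -
  let ?N = "CARD('n \<times> 'n)" and ?q = "1 - 1 / (2 * real CARD('n) ^ CARD('n \<times> 'n))"
  let ?d = "2 * (real ?N * R)"
  have n: "1 \<le> real CARD('n) ^ ?N" by (rule one_le_power) simp
  have "0 < 1 / (2 * y) \<and> 1 / (2 * y) \<le> 1" if "1 \<le> y" for y :: real
    using that by (simp add: field_simps)
  from this[OF n] have "0 < 1 / (2 * real CARD('n) ^ ?N)" "1 / (2 * real CARD('n) ^ ?N) \<le> 1"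
    by blast+
  then have q: "\<bar>?q\<bar> < 1" by linarith
  have "(\<lambda>m. ?q ^ m * ?d) \<longlonglongrightarrow> 0"
    using q by (intro tendsto_mult_left_zero LIMSEQ_power_zero) simp
  then have "\<forall>\<^sub>F m in sequentially. ?q ^ m * ?d < \<epsilon>"
    using assms by (rule order_tendstoD(2))
  then obtain m where m: "?q ^ m * ?d < \<epsilon>"
    using eventually_happens'[OF sequentially_bot] by blast
  show ?thesis
  proof (intro exI[of _ "m * ?N"] allI impI ballI)
    fix V :: "'n set" and nb x K k l i j
    assume run: "averaging_run V nb x K"
      and R: "\<forall>i\<in>V. \<forall>j\<in>nb 0 i. \<bar>x 0 $ i - x 0 $ j\<bar> \<le> R"
      and k: "k \<in> {m * ?N..K}" and l: "l \<in> {m * ?N..K}" and ij: "i \<in> V" "j \<in> V"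
    have kl: "m * ?N \<le> k" "k \<le> K" "m * ?N \<le> l" "l \<le> K" using k l by auto
    interpret averaging_run V nb x K by (rule run)
    obtain a where a: "\<forall>i\<in>V. x 0 $ i \<in> {a..a + ?d}" using initial_spread R by blast
    have "m * ?N \<le> K" using kl by simp
    from spread_contracts_iterated[OF a this] obtain a'
      where a': "\<forall>i\<in>V. x (m * ?N) $ i \<in> {a'..a' + ?q ^ m * ?d}" by blast
    have "x k $ i \<in> {a'..a' + ?q ^ m * ?d}" "x l $ j \<in> {a'..a' + ?q ^ m * ?d}"
      using hull_decreasing[OF kl(1,2) a'] hull_decreasing[OF kl(3,4) a'] ij by blast+
    then show "\<bar>x k $ i - x l $ j\<bar> \<le> \<epsilon>" using m by (auto simp: abs_le_iff)
  qed
qed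

section \<open>Eigenvalues and eigenvectors of graphs with self-loops\<close>

lemma dominates_induce_with_proj:
  "i \<rightarrow>\<^bsub>with_proj G \<restriction> V\<^esub> j \<longleftrightarrow> (i, j) \<in> parcs G \<and> i \<in> V \<and> j \<in> V"
  by (auto simp: arcs_ends_conv induce_subgraph_def)

lemma normalized_adjacency_mult:
  "(normalized_adjacency G *v x) $ i = (\<Sum>j\<in>neighbors G i. x $ j) / real (card (neighbors G i))"
proof -
  have deg: "(\<Sum>l\<in>UNIV. adjacency_matrix G $ i $ l) = real (card (neighbors G i))"
    by (simp add: adjacency_matrix_def neighbors_def sum.If_cases)
  have "(\<Sum>j\<in>UNIV. adjacency_matrix G $ i $ j * x $ j) = (\<Sum>j\<in>neighbors G i. x $ j)"
    by (simp add: adjacency_matrix_def neighbors_def if_distrib if_distribR sum.If_cases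
        cong: if_cong)
  then show ?thesis
    by (simp add: normalized_adjacency_def matrix_vector_mult_def deg sum_divide_distrib[symmetric])
qed

lemma eigenspace_eq_eigenvectors0: "eigenspace G c = eigenvectors0 G c"
  by (auto simp: eigenspace_def eigenvalues_def eigenvectors0_def)

lemma eigenvector_neighbor_sum:
  assumes "u \<in> eigenvectors0 G c"
  shows "(\<Sum>j\<in>neighbors G i. u $ j) = c * real (card (neighbors G i)) * u $ i"
proof (cases "neighbors G i = {}")
  case False
  then have "real (card (neighbors G i)) \<noteq> 0" by simp
  moreover have "(\<Sum>j\<in>neighbors G i. u $ j) / real (card (neighbors G i)) = c * u $ i"
    using assms normalized_adjacency_mult[of G u i] by (simp add: eigenvectors0_def)
  ultimately show ?thesis by (simp add: field_simps)
qed simp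

text \<open>
  At an entry of largest modulus, the average over the neighborhood cannot exceed this modulus;
  the self-loop keeps the average away from the opposite extreme, which excludes \<open>-1\<close>.
\<close>

lemma eigenvalue_bounds:
  assumes loops: "\<And>i. i \<in> verts G \<Longrightarrow> i \<rightarrow>\<^bsub>G\<^esub> i" and c: "c \<in> eigenvalues G"
  shows "-1 < c \<and> c \<le> 1"
proof -
  obtain u where u: "u \<in> eigenvectors0 G c" "u \<noteq> 0" using c by (auto simp: eigenvalues_def)
  define M where "M = Max (range (\<lambda>i. \<bar>u $ i\<bar>))"
  have le: "\<bar>u $ i\<bar> \<le> M" for i unfolding M_def by (intro Max_ge) auto
  have "M \<in> range (\<lambda>i. \<bar>u $ i\<bar>)" unfolding M_def by (intro Max_in) auto
  then obtain i where i: "\<bar>u $ i\<bar> = M" by auto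
  have M: "0 < M"
  proof -
    obtain j where "u $ j \<noteq> 0" using u(2) by (auto simp: vec_eq_iff)
    then show ?thesis using le[of j] by linarith
  qed
  let ?N = "neighbors G i"
  have "i \<in> verts G" using u(1) i M by (auto simp: eigenvectors0_def)
  then have iN: "i \<in> ?N" using loops by (simp add: neighbors_def)
  then have card: "0 < real (card ?N)" by (auto simp: card_gt_0_iff)
  define w where "w j = sgn (u $ i) * u $ j" for j
  have w: "\<bar>w j\<bar> \<le> M" for j
    using le[of j] M by (auto simp: w_def abs_mult abs_sgn_eq)
  have wi: "w i = M" using i by (simp add: w_def abs_sgn mult.commute)
  have sum: "(\<Sum>j\<in>?N. w j) = c * card ?N * M"
    unfolding w_def sum_distrib_left[symmetric] eigenvector_neighbor_sum[OF u(1)]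
    using wi by (simp add: w_def algebra_simps)
  have "c * card ?N * M \<le> card ?N * M"
    unfolding sum[symmetric] using w by (intro sum_bounded_above) (auto simp: abs_le_iff)
  then have "c \<le> 1" using card M by simp
  have "M + w i \<le> (\<Sum>j\<in>?N. M + w j)"
    using w iN by (intro member_le_sum) (auto simp: abs_le_iff, smt (verit))
  also have "\<dots> = (1 + c) * card ?N * M"
    by (simp add: sum.distrib sum algebra_simps)
  finally have "0 < (1 + c) * card ?N * M" using wi M by linarith
  then have "0 < (1 + c) * (card ?N * M)" by (simp only: mult.assoc)
  then have "0 < 1 + c" by (rule zero_less_mult_pos2) (use card M in simp)
  then show ?thesis using \<open>c \<le> 1\<close> by simp
qed

text \<open>
  The maximum principle: where \<open>u\<close> attains its maximum, it does so at all neighbors too.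
\<close>

lemma eigenvector_1_constant:
  assumes u: "u \<in> eigenvectors0 G 1"
    and conn: "\<And>i j. i \<in> verts G \<Longrightarrow> j \<in> verts G \<Longrightarrow> (i, j) \<in> (arcs_ends G)\<^sup>*"
    and dom: "\<And>i j. i \<rightarrow>\<^bsub>G\<^esub> j \<Longrightarrow> j \<in> verts G"
    and ij: "i \<in> verts G" "j \<in> verts G"
  shows "u $ i = u $ j"
proof -
  define M where "M = Max (($) u ` verts G)"
  have le: "u $ h \<le> M" if "h \<in> verts G" for h
    unfolding M_def using that by (intro Max_ge) auto
  have "M \<in> ($) u ` verts G" unfolding M_def using ij by (intro Max_in) auto
  then obtain g where g: "g \<in> verts G" "u $ g = M" by auto
  have "u $ h = M" if "(g, h) \<in> (arcs_ends G)\<^sup>*" for h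
    using that
  proof (induction rule: rtrancl_induct)
    case (step a b)
    let ?N = "neighbors G a"
    have "(\<Sum>j\<in>?N. M - u $ j) = 0"
      using eigenvector_neighbor_sum[OF u, of a] step.IH by (simp add: sum_subtractf)
    moreover have "0 \<le> M - u $ j" if "j \<in> ?N" for j
      using that dom le by (force simp: neighbors_def)
    ultimately have "\<forall>j\<in>?N. M - u $ j = 0"
      by (subst (asm) sum_nonneg_eq_0_iff) auto
    then show ?case using step.hyps(2) by (auto simp: neighbors_def)
  qed (rule g(2))
  then show ?thesis using conn g(1) ij by metis
qed

section \<open>Connectivity and components of symmetric graphs\<close>

lemma connected_imp_rtrancl:
  assumes "Digraph_Component.connected G" and sym: "\<And>i j. i \<rightarrow>\<^bsub>G\<^esub> j \<Longrightarrow> j \<rightarrow>\<^bsub>G\<^esub> i"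
    and "i \<in> verts G" "j \<in> verts G"
  shows "(i, j) \<in> (arcs_ends G)\<^sup>*"
proof -
  have "i \<rightarrow>\<^sup>*\<^bsub>with_proj (mk_symmetric G)\<^esub> j"
    using assms by (auto simp: Digraph_Component.connected_def strongly_connected_def mk_symmetric_def)
  then have "(i, j) \<in> (parcs (mk_symmetric G))\<^sup>*"
    using reachable_rtranclI by fastforce
  moreover have "parcs (mk_symmetric G) \<subseteq> arcs_ends G"
    using sym by (auto simp: mk_symmetric_def arcs_ends_conv)
  ultimately show ?thesis using rtrancl_mono by blast
qed

lemma (in wf_digraph) scc_closed_under_symmetric_arcs:
  assumes "G \<restriction> V \<in> sccs" "i \<in> V" "i \<rightarrow> j" "j \<rightarrow> i"
  shows "j \<in> V"
proof -
  have "verts (G \<restriction> V) \<in> sccs_verts"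
    using in_sccs_vertsI_sccs assms(1) by blast
  moreover have "i \<rightarrow>\<^sup>* j" "j \<rightarrow>\<^sup>* i"
    using assms(3,4) by (simp_all add: reachable_adjI)
  ultimately show ?thesis
    using assms(2) unfolding sccs_verts_def induce_subgraph_verts by blast
qed

section \<open>Boundary-restricted eigenspaces\<close>

lemma boundary_difference_in_boundary_eigenspace:
  assumes "u \<in> eigenvectors0 (with_proj Gph \<restriction> VP) c" "w \<in> eigenvectors0 (with_proj Gph \<restriction> VQ) c"
  shows "s *\<^sub>R (restrict_P (boundary_edges Gph VP VQ) u - restrict_Q (boundary_edges Gph VP VQ) w)
    \<in> boundary_eigenspace Gph VP VQ c"
proof -
  let ?B = "boundary_edges Gph VP VQ"
  have "s *\<^sub>R restrict_P ?B u \<in> span (restrict_P ?B ` eigenspace (with_proj Gph \<restriction> VP) c)"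
    "(- s) *\<^sub>R restrict_Q ?B w \<in> span (restrict_Q ?B ` eigenspace (with_proj Gph \<restriction> VQ) c)"
    by (rule span_scale[OF span_base], use assms in \<open>simp add: eigenspace_eq_eigenvectors0\<close>)+
  then show ?thesis
    unfolding boundary_eigenspace_def by (force simp: scaleR_diff_right)
qed

lemma subspace_boundary_eigenspace: "subspace (boundary_eigenspace Gph VP VQ c)"
  unfolding boundary_eigenspace_def by (intro subspace_sums subspace_span)

lemma boundary_eigenspace_vanishes:
  fixes Gph :: "'n::finite pair_pre_digraph"
  assumes "v \<in> boundary_eigenspace Gph VP VQ c" "e \<notin> boundary_edges Gph VP VQ"
  shows "v $ e = 0"
proof -
  let ?Z = "{v :: real ^ ('n \<times> 'n). v $ e = 0}"
  have Z: "subspace ?Z" by (simp add: subspace_def)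
  have "span (restrict_P (boundary_edges Gph VP VQ) ` U) \<subseteq> ?Z" for U
    by (rule span_minimal[OF _ Z]) (use assms(2) in \<open>auto simp: restrict_P_def\<close>)
  moreover have "span (restrict_Q (boundary_edges Gph VP VQ) ` U) \<subseteq> ?Z" for U
    by (rule span_minimal[OF _ Z]) (use assms(2) in \<open>auto simp: restrict_Q_def\<close>)
  ultimately show ?thesis using assms(1) unfolding boundary_eigenspace_def by fastforce
qed

section \<open>Hegselmann-Krause dynamics before merging\<close>

lemma hk_state_Suc: "hk_state Gph R x0 (Suc k) = hk_step Gph R (hk_state Gph R x0 k)"
  by (simp add: hk_state_def)

lemma dominates_hk_graph:
  "i \<rightarrow>\<^bsub>hk_graph Gph R x0 k\<^esub> j \<longleftrightarrow>
    (i, j) \<in> parcs Gph \<and> \<bar>hk_state Gph R x0 k $ i - hk_state Gph R x0 k $ j\<bar> \<le> R"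
  by (auto simp: hk_graph_def influence_graph_def)

lemma neighbors_hk_graph:
  "neighbors (hk_graph Gph R x0 k) i =
    {j. (i, j) \<in> parcs Gph \<and> \<bar>hk_state Gph R x0 k $ i - hk_state Gph R x0 k $ j\<bar> \<le> R}"
  by (simp add: neighbors_def dominates_hk_graph)

context
  fixes Gph :: "'n::finite pair_pre_digraph" and R :: real and VP VQ :: "'n set"
  assumes R: "0 < R" and sym: "pair_sym_digraph Gph" and verts: "pverts Gph = UNIV"
    and loops: "\<forall>i. (i, i) \<in> parcs Gph"
begin

lemma parcs_sym: "(i, j) \<in> parcs Gph \<Longrightarrow> (j, i) \<in> parcs Gph"
  using pair_sym_digraph.arcs_symmetric[OF sym] .

text \<open>
  The neighborhoods stay within \<open>V\<close> because \<open>V\<close> is a component, they grow because no link breaks,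
  and they are connected at time \<open>0\<close> because this time precedes the merging time.
\<close>

lemma merging_run:
  assumes x0: "x0 \<in> merging_states Gph R VP VQ" and V: "V \<in> {VP, VQ}"
  shows "averaging_run V (\<lambda>k. neighbors (hk_graph Gph R x0 k)) (hk_state Gph R x0)
    (merge_time Gph R VP VQ x0)"
proof
  let ?K = "merge_time Gph R VP VQ x0" and ?G = "hk_graph Gph R x0"
  let ?nb = "\<lambda>k. neighbors (?G k)"
  have "\<exists>k. merge_at Gph R x0 VP VQ k" using x0 by (simp add: merging_states_def)
  then have "merge_at Gph R x0 VP VQ ?K" unfolding merge_time_def by (rule LeastI_ex)
  then show K: "0 < ?K" by (simp add: merge_at_def)
  have symG: "i \<rightarrow>\<^bsub>?G k\<^esub> j \<Longrightarrow> j \<rightarrow>\<^bsub>?G k\<^esub> i" for i j k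
    using parcs_sym by (auto simp: dominates_hk_graph abs_minus_commute)
  have wf: "wf_digraph (?G k)" for k
    by unfold_locales (simp_all add: hk_graph_def influence_graph_def verts)
  show "hk_state Gph R x0 (Suc k) $ i =
      (\<Sum>j\<in>?nb k i. hk_state Gph R x0 k $ j) / real (card (?nb k i))" for k i
    by (simp add: hk_state_Suc hk_step_def hk_graph_def)
  show "i \<in> ?nb k i" for k i
    using loops R by (simp add: neighbors_hk_graph)
  show "?nb k i \<subseteq> V" if "k < ?K" "i \<in> V" for k i
  proof
    fix j assume "j \<in> ?nb k i"
    then have "i \<rightarrow>\<^bsub>?G k\<^esub> j" by (simp add: neighbors_def)
    moreover have "?G k \<restriction> V \<in> pre_digraph.sccs (?G k)"
      using x0 V that(1) by (auto simp: merging_states_def)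
    ultimately show "j \<in> V"
      using wf_digraph.scc_closed_under_symmetric_arcs[OF wf] symG that(2) by blast
  qed
  then have closed: "j \<in> V" if "k < ?K" "i \<in> V" "j \<in> ?nb k i" for i j k using that by blast
  show "?nb k i \<subseteq> ?nb l i" if "k \<le> l" "l < ?K" "i \<in> V" for k l i
    using that(1,2)
  proof (induction l rule: dec_induct)
    case (step l)
    have "?nb l i \<subseteq> ?nb (Suc l) i"
    proof
      fix j assume j: "j \<in> ?nb l i"
      then have "j \<in> V" using closed[of l i j] step.prems that(3) by simp
      then have "\<not> link_break Gph R x0 i j (Suc l)"
        using x0 V that(3) step.prems by (auto simp: merging_states_def)
      then show "j \<in> ?nb (Suc l) i" using j by (simp add: link_break_def neighbors_def)
    qed
    then show ?case using step by auto
  qed simp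
  show "(i, j) \<in> {(a, b). a \<in> V \<and> b \<in> ?nb 0 a}\<^sup>*" if ij: "i \<in> V" "j \<in> V" for i j
  proof -
    have "Digraph_Component.connected (?G 0 \<restriction> V)"
      using x0 V K by (auto simp: merging_states_def)
    moreover have dom: "a \<rightarrow>\<^bsub>?G 0 \<restriction> V\<^esub> b \<longleftrightarrow> a \<rightarrow>\<^bsub>?G 0\<^esub> b \<and> a \<in> V \<and> b \<in> V" for a b
      unfolding hk_graph_def by (simp only: dominates_induce_with_proj with_proj_simps)
    ultimately have "(i, j) \<in> (arcs_ends (?G 0 \<restriction> V))\<^sup>*"
      using symG ij by (intro connected_imp_rtrancl) auto
    moreover have "arcs_ends (?G 0 \<restriction> V) \<subseteq> {(a, b). a \<in> V \<and> b \<in> ?nb 0 a}"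
      using dom by (auto simp: neighbors_def)
    ultimately show ?thesis using rtrancl_mono by blast
  qed
qed

lemma merging_boundary_gap:
  assumes x0: "x0 \<in> merging_states Gph R VP VQ" and disj: "VP \<inter> VQ = {}"
    and e: "e \<in> boundary_edges Gph VP VQ" and k: "k < merge_time Gph R VP VQ x0"
  shows "R < \<bar>hk_state Gph R x0 k $ fst e - hk_state Gph R x0 k $ snd e\<bar>"
proof (rule ccontr)
  assume "\<not> ?thesis"
  then have "snd e \<in> neighbors (hk_graph Gph R x0 k) (fst e)"
    using e by (auto simp: neighbors_hk_graph boundary_edges_def)
  moreover have "fst e \<in> VP" "snd e \<in> VQ" using e by (auto simp: boundary_edges_def)
  ultimately show False
    using averaging_run.closed[OF merging_run[OF x0, of VP] k] disj by auto
qed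

lemma merging_boundary_edge:
  assumes x0: "x0 \<in> merging_states Gph R VP VQ"
  obtains e where "e \<in> boundary_edges Gph VP VQ"
    "\<bar>hk_state Gph R x0 (merge_time Gph R VP VQ x0) $ fst e
      - hk_state Gph R x0 (merge_time Gph R VP VQ x0) $ snd e\<bar> \<le> R"
proof -
  have "\<exists>k. merge_at Gph R x0 VP VQ k" using x0 by (simp add: merging_states_def)
  then have "merge_at Gph R x0 VP VQ (merge_time Gph R VP VQ x0)"
    unfolding merge_time_def by (rule LeastI_ex)
  then obtain i j where "(i, j) \<in> boundary_edges Gph VP VQ"
    "\<bar>hk_state Gph R x0 (merge_time Gph R VP VQ x0) $ i
      - hk_state Gph R x0 (merge_time Gph R VP VQ x0) $ j\<bar> \<le> R"
    by (auto simp: merge_at_def dominates_hk_graph boundary_edges_def)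
  then show ?thesis using that by fastforce
qed

text \<open>
  Once all opinions of \<open>V\<close> are within distance \<open>R\<close> of each other, the active links within \<open>V\<close> are
  exactly the physical ones, so each step multiplies by the normalized adjacency matrix.
\<close>

lemma clustered_eigen_expansion:
  assumes run: "averaging_run V (\<lambda>k. neighbors (hk_graph Gph R x0 k)) (hk_state Gph R x0) K"
    and near: "\<And>k i j. T \<le> k \<Longrightarrow> k \<le> K \<Longrightarrow> i \<in> V \<Longrightarrow> j \<in> V \<Longrightarrow>
      \<bar>hk_state Gph R x0 k $ i - hk_state Gph R x0 k $ j\<bar> \<le> R"
    and C: "finite C" "eigenvalues (with_proj Gph \<restriction> V) \<union> {0} \<subseteq> C"
  shows "\<exists>u. (\<forall>c. u c \<in> eigenvectors0 (with_proj Gph \<restriction> V) c) \<and>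
    (\<forall>k i. T + k \<le> K \<longrightarrow> i \<in> V \<longrightarrow> hk_state Gph R x0 (T + k) $ i = (\<Sum>c\<in>C. c ^ k * u c $ i))"
proof -
  let ?G = "with_proj Gph \<restriction> V" and ?x = "hk_state Gph R x0"
  interpret averaging_run V "\<lambda>k. neighbors (hk_graph Gph R x0 k)" ?x K by (rule run)
  define y where "y k = (\<chi> i. if i \<in> V then ?x k $ i else 0)" for k
  have y_Suc: "y (Suc k) = normalized_adjacency ?G *v y k" if k: "T \<le> k" "k < K" for k
    unfolding vec_eq_iff
  proof
    fix i
    show "y (Suc k) $ i = (normalized_adjacency ?G *v y k) $ i"
    proof (cases "i \<in> V")
      case True
      have "neighbors ?G i = neighbors (hk_graph Gph R x0 k) i"
        using closed[OF k(2) True] near[OF k(1) _ True] k(2) True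
        by (auto simp: neighbors_def dominates_induce_with_proj dominates_hk_graph)
      moreover have "(\<Sum>j\<in>neighbors (hk_graph Gph R x0 k) i. y k $ j)
          = (\<Sum>j\<in>neighbors (hk_graph Gph R x0 k) i. ?x k $ j)"
        using closed[OF k(2) True] by (intro sum.cong refl) (auto simp: y_def)
      ultimately show ?thesis
        unfolding normalized_adjacency_mult using step[OF k(2) True] True by (simp add: y_def)
    next
      case False
      then have "neighbors ?G i = {}" by (auto simp: neighbors_def dominates_induce_with_proj)
      then show ?thesis using False by (simp add: normalized_adjacency_mult y_def)
    qed
  qed
  have "\<exists>u. (\<forall>c. u c \<in> eigenvectors0 ?G c) \<and> y T = (\<Sum>c\<in>C. u c)"
    by (rule normalized_adjacency_eigen_decomposition[of ?G C "y T"])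
      (use C parcs_sym loops in \<open>auto simp: dominates_induce_with_proj y_def\<close>)
  then obtain u where u: "\<forall>c. u c \<in> eigenvectors0 ?G c" "y T = (\<Sum>c\<in>C. u c)" by blast
  have y_modes: "y (T + k) = (\<Sum>c\<in>C. c ^ k *\<^sub>R u c)" if "T + k \<le> K" for k
    using that
  proof (induction k)
    case (Suc k)
    have Au: "normalized_adjacency ?G *v u c = c *\<^sub>R u c" for c
      using u(1) by (simp add: eigenvectors0_def)
    have "y (T + Suc k) = normalized_adjacency ?G *v (\<Sum>c\<in>C. c ^ k *\<^sub>R u c)"
      using Suc y_Suc[of "T + k"] by simp
    also have "\<dots> = (\<Sum>c\<in>C. c ^ k *\<^sub>R (normalized_adjacency ?G *v u c))"
      by (simp add: linear_sum[OF matrix_vector_mul_linear] linear_scale[OF matrix_vector_mul_linear])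
    also have "\<dots> = (\<Sum>c\<in>C. c ^ Suc k *\<^sub>R u c)"
      by (simp add: Au mult.commute)
    finally show ?case .
  qed (simp add: u(2))
  have "?x (T + k) $ i = (\<Sum>c\<in>C. c ^ k * u c $ i)" if "T + k \<le> K" "i \<in> V" for k i
  proof -
    have "?x (T + k) $ i = y (T + k) $ i" using that(2) by (simp add: y_def)
    then show ?thesis by (simp add: y_modes[OF that(1)])
  qed
  then show ?thesis using u(1) by blast
qed

text \<open>
  Every late merging yields a family of modes as in \<open>late_sign_change_imp_nonneg_mode\<close>: the mode
  of rate \<open>c \<noteq> 1\<close> is the difference across the boundary of the components for eigenvalue \<open>c\<close>, up
  to sign, and the mode of rate \<open>1\<close> is, up to the same sign, the difference of the constant parts
  of the two groups, minus the threshold \<open>R\<close>.  Time is counted from \<open>T\<close>.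
\<close>

lemma late_merging_modes:
  assumes disj: "VP \<inter> VQ = {}"
    and C: "finite C" "0 \<notin> C" "1 \<in> C"
      "eigenvalues (with_proj Gph \<restriction> VP) \<union> eigenvalues (with_proj Gph \<restriction> VQ) \<subseteq> insert 0 C"
    and unbounded: "\<And>N. \<exists>x0\<in>merging_states Gph R VP VQ. N < merge_time Gph R VP VQ x0"
  defines "B \<equiv> boundary_edges Gph VP VQ"
  shows "\<exists>K v. N \<le> K
    \<and> (\<forall>c\<in>C. v c \<in> (if c = 1 then range (\<lambda>t. \<chi> e. if e \<in> B then t else 0)
                          else boundary_eigenspace Gph VP VQ c))
    \<and> (\<forall>k\<in>{1..<K}. \<forall>e\<in>B. 0 < (\<Sum>c\<in>C. c ^ k * v c $ e))
    \<and> (\<exists>e\<in>B. (\<Sum>c\<in>C. c ^ K * v c $ e) \<le> 0)"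
proof -
  let ?GP = "with_proj Gph \<restriction> VP" and ?GQ = "with_proj Gph \<restriction> VQ"
  have "0 < R / 4" using R by simp
  from uniform_clustering[OF this, of R]
  obtain T where T: "\<forall>(V :: 'n set) nb x K. averaging_run V nb x K \<longrightarrow>
    (\<forall>i\<in>V. \<forall>j\<in>nb 0 i. \<bar>x 0 $ i - x 0 $ j\<bar> \<le> R) \<longrightarrow>
    (\<forall>k\<in>{T..K}. \<forall>l\<in>{T..K}. \<forall>i\<in>V. \<forall>j\<in>V. \<bar>x k $ i - x l $ j\<bar> \<le> R / 4)" ..
  obtain x0 where x0: "x0 \<in> merging_states Gph R VP VQ" and late: "T + Suc N < merge_time Gph R VP VQ x0"
    using unbounded by blast
  define x where "x = hk_state Gph R x0"
  define M where "M = merge_time Gph R VP VQ x0"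
  define K where "K = M - T"
  have K: "T + K = M" "N \<le> K" "1 < K" using late by (auto simp: K_def M_def)
  have run: "averaging_run V (\<lambda>k. neighbors (hk_graph Gph R x0 k)) x M" if "V \<in> {VP, VQ}" for V
    unfolding x_def M_def by (rule merging_run[OF x0 that])
  have near: "\<bar>x k $ i - x l $ j\<bar> \<le> R / 4"
    if "V \<in> {VP, VQ}" "T \<le> k" "k \<le> M" "T \<le> l" "l \<le> M" "i \<in> V" "j \<in> V" for V k l i j
  proof -
    have "\<forall>i\<in>V. \<forall>j\<in>neighbors (hk_graph Gph R x0 0) i. \<bar>x 0 $ i - x 0 $ j\<bar> \<le> R"
      by (simp add: neighbors_hk_graph x_def)
    with T[rule_format, OF run[OF that(1)]] that(2-) show ?thesis by simp
  qed
  have expand: "\<exists>u. (\<forall>c. u c \<in> eigenvectors0 (with_proj Gph \<restriction> V) c) \<and>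
      (\<forall>k i. T + k \<le> M \<longrightarrow> i \<in> V \<longrightarrow> x (T + k) $ i = (\<Sum>c\<in>insert 0 C. c ^ k * u c $ i))"
    if V: "V \<in> {VP, VQ}" for V
  proof -
    have close: "\<bar>hk_state Gph R x0 k $ i - hk_state Gph R x0 k $ j\<bar> \<le> R"
      if "T \<le> k" "k \<le> M" "i \<in> V" "j \<in> V" for k i j
      using near[OF V that(1,2,1,2,3,4)] R by (simp add: x_def)
    have "finite (insert 0 C)" "eigenvalues (with_proj Gph \<restriction> V) \<union> {0} \<subseteq> insert 0 C"
      using V C by auto
    then show ?thesis
      unfolding x_def using close
      by (intro clustered_eigen_expansion[OF run[OF V, unfolded x_def]]) blast+
  qed
  obtain uP where uP: "\<And>c. uP c \<in> eigenvectors0 ?GP c"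
    and xP: "\<And>k i. T + k \<le> M \<Longrightarrow> i \<in> VP \<Longrightarrow> x (T + k) $ i = (\<Sum>c\<in>insert 0 C. c ^ k * uP c $ i)"
    using expand[of VP] by auto
  obtain uQ where uQ: "\<And>c. uQ c \<in> eigenvectors0 ?GQ c"
    and xQ: "\<And>k i. T + k \<le> M \<Longrightarrow> i \<in> VQ \<Longrightarrow> x (T + k) $ i = (\<Sum>c\<in>insert 0 C. c ^ k * uQ c $ i)"
    using expand[of VQ] by auto
  have const: "u $ i = u $ j"
    if V: "V \<in> {VP, VQ}" and u: "u \<in> eigenvectors0 (with_proj Gph \<restriction> V) 1" and ij: "i \<in> V" "j \<in> V"
    for V u i j
  proof (rule eigenvector_1_constant[OF u])
    interpret averaging_run V "\<lambda>k. neighbors (hk_graph Gph R x0 k)" x M by (rule run[OF V])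
    have "links \<subseteq> arcs_ends (with_proj Gph \<restriction> V)"
    proof clarify
      fix a b assume ab: "a \<in> V" "b \<in> neighbors (hk_graph Gph R x0 0) a"
      then have "b \<in> V" using closed[OF horizon] by blast
      then show "a \<rightarrow>\<^bsub>with_proj Gph \<restriction> V\<^esub> b"
        using ab by (simp add: dominates_induce_with_proj neighbors_hk_graph)
    qed
    then show "(a, b) \<in> (arcs_ends (with_proj Gph \<restriction> V))\<^sup>*"
      if "a \<in> verts (with_proj Gph \<restriction> V)" "b \<in> verts (with_proj Gph \<restriction> V)" for a b
      using conn[of a b] that rtrancl_mono by (auto simp: induce_subgraph_verts)
  qed (use ij in \<open>auto simp: dominates_induce_with_proj\<close>)
  have BV: "fst e \<in> VP" "snd e \<in> VQ" if "e \<in> B" for e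
    using that by (auto simp: B_def boundary_edges_def)
  obtain e0 where e0: "e0 \<in> B" and e0_close: "\<bar>x M $ fst e0 - x M $ snd e0\<bar> \<le> R"
    using merging_boundary_edge[OF x0] unfolding B_def x_def M_def by blast
  define g where "g k e = x k $ fst e - x k $ snd e" for k e
  have gap: "R < \<bar>g k e\<bar>" if "k < M" "e \<in> B" for k e
    using merging_boundary_gap[OF x0 disj] that by (simp add: g_def x_def M_def B_def)
  \<comment> \<open>Each endpoint is within \<open>R / 4\<close> of that of \<open>e0\<close> at time \<open>T\<close>, whereas a difference of
      opposite sign would be more than \<open>R\<close> away.\<close>
  have g_near: "\<bar>g k e - g T e0\<bar> \<le> R / 2" if "T \<le> k" "k \<le> M" "e \<in> B" for k e
  proof -
    have "T \<le> M" using that by simp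
    then have "\<bar>x k $ fst e - x T $ fst e0\<bar> \<le> R / 4" "\<bar>x k $ snd e - x T $ snd e0\<bar> \<le> R / 4"
      using near[of VP] near[of VQ] that BV[OF that(3)] BV[OF e0] by simp_all
    then show ?thesis unfolding g_def by linarith
  qed
  define s where "s = sgn (g T e0)"
  have "T < M" using K by simp
  have sg: "s * g k e = \<bar>g k e\<bar>" if "T \<le> k" "k \<le> M" "e \<in> B" for k e
  proof (cases "0 < g T e0")
    case True
    then have "0 < g k e" using g_near[OF that] gap[OF \<open>T < M\<close> e0] R by linarith
    then show ?thesis using True by (simp add: s_def)
  next
    case False
    then have "g T e0 < 0" "g k e < 0" using g_near[OF that] gap[OF \<open>T < M\<close> e0] R by linarith+
    then show ?thesis by (simp add: s_def)
  qed
  define v where "v c = (if c = 1 then \<chi> e. if e \<in> B then s * (uP 1 $ fst e0 - uQ 1 $ snd e0) - R else 0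
      else s *\<^sub>R (restrict_P B (uP c) - restrict_Q B (uQ c)))" for c
  have v_sum: "(\<Sum>c\<in>C. c ^ k * v c $ e) = \<bar>g (T + k) e\<bar> - R" if k: "1 \<le> k" "k \<le> K" and e: "e \<in> B" for k e
  proof -
    have "v c $ e = s * (uP c $ fst e - uQ c $ snd e) - (if c = 1 then R else 0)" for c
      using e BV[OF e] BV[OF e0] const[OF _ uP, of "fst e" "fst e0"] const[OF _ uQ, of "snd e" "snd e0"]
      by (auto simp: v_def restrict_P_def restrict_Q_def)
    then have "(\<Sum>c\<in>C. c ^ k * v c $ e)
        = (\<Sum>c\<in>C. s * (c ^ k * uP c $ fst e - c ^ k * uQ c $ snd e) - (if c = 1 then R else 0))"
      by (intro sum.cong refl) (simp only:, simp add: right_diff_distrib mult.left_commute)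
    also have "\<dots> = s * ((\<Sum>c\<in>C. c ^ k * uP c $ fst e) - (\<Sum>c\<in>C. c ^ k * uQ c $ snd e)) - R"
      using C(1,3) by (simp add: sum_subtractf sum_distrib_left[symmetric])
    also have "\<dots> = s * g (T + k) e - R"
      using xP[of k "fst e"] xQ[of k "snd e"] BV[OF e] k K(1) C(1,2) by (simp add: g_def)
    finally show ?thesis using sg[of "T + k" e] k e K(1) by simp
  qed
  have "v c \<in> (if c = 1 then range (\<lambda>t. \<chi> e. if e \<in> B then t else 0) else boundary_eigenspace Gph VP VQ c)" for c
    using boundary_difference_in_boundary_eigenspace[OF uP uQ, of s c]
    by (auto simp: v_def B_def)
  moreover have "0 < (\<Sum>c\<in>C. c ^ k * v c $ e)" if "k \<in> {1..<K}" "e \<in> B" for k e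
    using v_sum[of k e] gap[of "T + k" e] that K(1) by simp
  moreover have "(\<Sum>c\<in>C. c ^ K * v c $ e0) \<le> 0"
    using v_sum[of K e0] e0 e0_close K by (simp add: g_def)
  ultimately show ?thesis using K(2) e0 by blast
qed

end

section \<open>Unbounded merging times\<close>

theorem proposition6:
  fixes Gph :: "'n::finite pair_pre_digraph"
    and R :: real
    and VP VQ :: "'n set"
    and m :: nat
    and lam :: "nat \<Rightarrow> real"
  assumes "R > 0"
    and "pair_sym_digraph Gph"
    and "pverts Gph = UNIV"
    and "\<forall>i. (i, i) \<in> parcs Gph"
    and "Digraph_Component.connected (with_proj Gph)"
    and "VP \<inter> VQ = {}"
    and "lam ` {1..m} \<union> {1} =
           eigenvalues (with_proj Gph \<restriction> VP) \<union> eigenvalues (with_proj Gph \<restriction> VQ)"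
    and "\<forall>d\<in>{1..m}. lam d \<noteq> 1"
    and "(SUP x0 \<in> merging_states Gph R VP VQ. enat (merge_time Gph R VP VQ x0)) = \<infinity>"
  shows "\<exists>d\<in>{1..m}. 0 < lam d \<and> lam d < 1 \<and>
           (\<exists>v \<in> boundary_eigenspace Gph VP VQ (lam d).
              (\<exists>e\<in>boundary_edges Gph VP VQ. v $ e \<noteq> 0) \<and>
              (\<forall>e\<in>boundary_edges Gph VP VQ. \<forall>f\<in>boundary_edges Gph VP VQ. v $ e * v $ f \<ge> 0))"
proof -
  let ?B = "boundary_edges Gph VP VQ"
  define C where "C = lam ` {1..m} \<union> {1} - {0}"
  define V where "V c = (if c = 1 then range (\<lambda>t. \<chi> e. if e \<in> ?B then t else 0)
    else boundary_eigenspace Gph VP VQ c)" for c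
  have unbounded: "\<exists>x0\<in>merging_states Gph R VP VQ. N < merge_time Gph R VP VQ x0" for N
  proof -
    have "enat N < (SUP x0 \<in> merging_states Gph R VP VQ. enat (merge_time Gph R VP VQ x0))"
      unfolding assms(9) by simp
    then show ?thesis by (simp add: less_SUP_iff)
  qed
  have C: "finite C" "0 \<notin> C" "1 \<in> C"
    "eigenvalues (with_proj Gph \<restriction> VP) \<union> eigenvalues (with_proj Gph \<restriction> VQ) \<subseteq> insert 0 C"
    unfolding C_def assms(7)[symmetric] by auto
  have bounds: "-1 < c \<and> c \<le> 1 \<and> c \<noteq> 0" if "c \<in> C" for c
  proof -
    have "c \<in> eigenvalues (with_proj Gph \<restriction> VP) \<union> eigenvalues (with_proj Gph \<restriction> VQ)"
      using that assms(7) by (auto simp: C_def)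
    then have "-1 < c \<and> c \<le> 1"
      using eigenvalue_bounds[of "with_proj Gph \<restriction> VP" c] eigenvalue_bounds[of "with_proj Gph \<restriction> VQ" c] assms(4)
      by (auto simp: dominates_induce_with_proj)
    then show ?thesis using that C(2) by blast
  qed
  have "subspace (range (\<lambda>t. (\<chi> e. if e \<in> ?B then t else 0) :: real ^ ('n \<times> 'n)))"
    by (intro linear_subspace_image subspace_UNIV linearI) (auto simp: vec_eq_iff)
  then have V: "subspace (V c)" if "c \<in> C" for c
    by (simp add: V_def subspace_boundary_eigenspace)
  have supp: "v $ e = 0" if "c \<in> C" "v \<in> V c" "e \<notin> ?B" for c v e
    using that boundary_eigenspace_vanishes[of v Gph VP VQ c e] by (auto simp: V_def split: if_splits)
  have const: "v $ e = v $ f" if "v \<in> V 1" "e \<in> ?B" "f \<in> ?B" for v e f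
    using that by (auto simp: V_def)
  note late = late_merging_modes[OF assms(1-4,6) C unbounded, folded V_def]
  have "\<exists>c\<in>C. 0 < c \<and> c < 1 \<and> (\<exists>v\<in>V c. (\<exists>e\<in>?B. v $ e \<noteq> 0) \<and> (\<forall>e\<in>?B. 0 \<le> v $ e))"
    by (rule late_sign_change_imp_nonneg_mode) (fact C(1) bounds V supp const late)+
  then obtain c v where c: "c \<in> C" "0 < c" "c < 1"
    and v: "v \<in> V c" "\<exists>e\<in>?B. v $ e \<noteq> 0" "\<forall>e\<in>?B. 0 \<le> v $ e" by blast
  obtain d where "d \<in> {1..m}" "lam d = c" using c by (auto simp: C_def)
  then show ?thesis
    using c v by (intro bexI[of _ d] conjI bexI[of _ v]) (auto simp: V_def)
qed

end
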